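(* Let $0 \le \lambda_0 < \lambda_1 \le \infty$ and let $I = (\lambda_0, \lambda_1)$. Let $A$ be a property that is rapidly determined over the interval $I$. Then the function $f_A(\lambda) = \mathbb{P}_\lambda(A)$ is real analytic on $I$; that is, for every $\lambda \in I$ there exists $\delta > 0$ such that $f_A$ extends to a complex analytic function on the disc $\{z \in \mathbb{C} : |z - \lambda| \le \delta\}$.
   Context: $\mathbb{N} = \{0,1,2,\dots\}$. For $\lambda \in (0,\infty)$, $\mathbb{P}_\lambda$ denotes the law under which $\widetilde{X} = (X_1, X_2, \dots)$ (the seed) is a sequence of i.i.d. Poisson($\lambda$) random variables. The seed determines a rooted ordered tree $T$ (the Poisson Galton–Watson tree) with nodes labelled in breadth first order (top to bottom, left to right, the root being node $1$): node $i$, if it exists, has $X_i$ children. If $T$ has a finite number $n$ of vertices, the values $X_j$, $j>n$, are irrelevant to $T$. A property $A$ of $T$ is identified with the (measurable) event $\{T \text{ has property } A\}$, viewed as an event on the seed, and $f_A(\lambda) := \mathbb{P}_\lambda(A)$. For $k\ge 1$ let $\widetilde{X}^{(k)} = (X_1,\dots,X_k)$. An event $A$ is called $k$-tautologically determined if there exists a set $B \subseteq \mathbb{N}^k$ such that $A = \{\widetilde{X}^{(k)} \in B\}$. An event $A$ is called rapidly determined over an interval $I=(\lambda_0,\lambda_1)$, where $0\le\lambda_0<\lambda_1\le\infty$, if there is a sequence of events $(A_k)_{k\ge1}$ (not depending on $\lambda$), with $A_k$ being $k$-tautologically determined, such that for every $\lambda \in I$ there exist constants $c, C > 0$ and $k_0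 \in \mathbb{N}$ (which may depend on $\lambda$) with $\mathbb{P}_\lambda(A \triangle A_k) \le C e^{-ck}$ for all $k \ge k_0$. *)

theory Defs
  imports "HOL-Probability.Probability" "HOL-Complex_Analysis.Complex_Analysis"
begin

text \<open>
  Rooted ordered trees in which every node has finitely many children; being a codatatype, it
  contains the infinite trees as well as the finite ones.
\<close>

codatatype otree = Node (children: "otree list")

text \<open>
  A seed is a sequence \<open>x :: nat \<Rightarrow> nat\<close>. Nodes and seed entries are numbered from \<open>0\<close>: the
  informal \<open>X\<^sub>i\<close> is \<open>x (i - 1)\<close> and the root is node \<open>0\<close>. In the breadth first
  labelling the root and the children of the nodes before \<open>i\<close> take the labels
  \<open>0, \<dots>, x 0 + \<dots> + x (i - 1)\<close>, so the children of node \<open>i\<close> receive the next \<open>x i\<close> labels.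
\<close>

definition first_child :: "(nat \<Rightarrow> nat) \<Rightarrow> nat \<Rightarrow> nat" where
  "first_child x i = 1 + (\<Sum>j<i. x j)"

text \<open>
  The subtree rooted at node \<open>i\<close>; its value is meaningful only if node \<open>i\<close> exists, and it
  refers only to descendants of \<open>i\<close>.
\<close>

primcorec subtree_at :: "(nat \<Rightarrow> nat) \<Rightarrow> nat \<Rightarrow> otree" where
  "subtree_at x i = Node (map (subtree_at x) [first_child x i ..< first_child x i + x i])"

definition seed_tree :: "(nat \<Rightarrow> nat) \<Rightarrow> otree" where
  "seed_tree x = subtree_at x 0"

definition seed_algebra :: "(nat \<Rightarrow> nat) measure" where
  "seed_algebra = (\<Pi>\<^sub>M i\<in>UNIV. count_space UNIV)"

text \<open>The law of the seed; only meaningful for \<open>r > 0\<close>, as is \<^const>\<open>poisson_pmf\<close>.\<close>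

definition seed_law :: "real \<Rightarrow> (nat \<Rightarrow> nat) measure" where
  "seed_law r = (\<Pi>\<^sub>M i\<in>UNIV. measure_pmf (poisson_pmf r))"

lemma sets_seed_law: "sets (seed_law r) = sets seed_algebra"
  unfolding seed_law_def seed_algebra_def by (intro sets_PiM_cong) auto

definition tree_event :: "(otree \<Rightarrow> bool) \<Rightarrow> (nat \<Rightarrow> nat) set" where
  "tree_event P = {x. P (seed_tree x)}"

definition event_prob :: "(nat \<Rightarrow> nat) set \<Rightarrow> real \<Rightarrow> real" where
  "event_prob A r = measure (seed_law r) A"

text \<open>\<open>\<nat>\<^sup>k\<close> is rendered as the set of lists of length \<open>k\<close>.\<close>

definition tautologically_determined :: "nat \<Rightarrow> (nat \<Rightarrow> nat) set \<Rightarrow> bool" where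
  "tautologically_determined k A \<longleftrightarrow>
     (\<exists>B \<subseteq> {xs. length xs = k}. A = {x. map x [0..<k] \<in> B})"

definition rapidly_determined :: "(nat \<Rightarrow> nat) set \<Rightarrow> real set \<Rightarrow> bool" where
  "rapidly_determined A I \<longleftrightarrow>
     (\<exists>Ak :: nat \<Rightarrow> (nat \<Rightarrow> nat) set.
        (\<forall>k\<ge>1. tautologically_determined k (Ak k)) \<and>
        (\<forall>r\<in>I. \<exists>c>0. \<exists>C>0. \<exists>k0::nat. \<forall>k\<ge>1. k \<ge> k0 \<longrightarrow>
           measure (seed_law r) (sym_diff A (Ak k)) \<le> C * exp (- c * real k)))"

definition real_analytic_on :: "(real \<Rightarrow> real) \<Rightarrow> real set \<Rightarrow> bool" where
  "real_analytic_on f I \<longleftrightarrow>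
     (\<forall>r\<in>I. \<exists>\<delta>>0. \<exists>g :: complex \<Rightarrow> complex.
        g analytic_on cball (of_real r) \<delta> \<and>
        (\<forall>x\<in>I. of_real x \<in> cball (of_real r :: complex) \<delta> \<longrightarrow> g (of_real x) = of_real (f x)))"

end

theory Submission
  imports Defs "HOL-Real_Asymp.Real_Asymp"
begin

text \<open>
  For an event \<open>E\<close> determined by the first \<open>k\<close> entries, \<open>e\<^sup>k\<^sup>r P\<^sub>r(E)\<close> is a power series in \<open>r\<close> with
  nonnegative coefficients, so \<open>P\<^sub>r(E)\<close> extends to an entire function \<open>G\<close>. The Cauchy-Schwarz
  inequality, applied to the series at \<open>r\<close> and at \<open>\<bar>z\<bar>\<^sup>2 / r\<close>, together with the trivial bound
  \<open>P \<le> 1\<close> at the latter point, gives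
  \<open>\<bar>G(z)\<bar> \<le> sqrt (P\<^sub>r(E)) exp (k \<bar>z - r\<bar>\<^sup>2 / (2 r))\<close>.
  Hence exponential decay at the single parameter \<open>r\<close> of the probability that consecutive
  approximations differ yields exponential decay of the differences of their extensions on a whole
  complex disc around \<open>r\<close>; the telescoping series converges uniformly there.
\<close>

lemma sqrt_exp: "sqrt (exp x) = exp (x / 2)" for x :: real
  by (rule real_sqrt_unique) (auto simp: power2_eq_square exp_add[symmetric])

section \<open>The seed law on cylinders\<close>

lemma prob_space_seed_law: "prob_space (seed_law r)"
  unfolding seed_law_def by (intro prob_space_PiM prob_space_measure_pmf)

text \<open>Written as a box with singleton sides, a cylinder is measurable in the product space,
  and independence turns its probability into a product of point masses.\<close>

lemma cylinder_eq_prod_emb: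
  assumes "length xs = k"
  shows "{x :: nat \<Rightarrow> nat. map x [0..<k] = xs} =
    prod_emb UNIV (\<lambda>i. measure_pmf (poisson_pmf r)) {..<k} (PiE {..<k} (\<lambda>i. {xs ! i}))"
proof -
  have "x \<in> prod_emb UNIV (\<lambda>i. measure_pmf (poisson_pmf r)) {..<k} (PiE {..<k} (\<lambda>i. {xs ! i})) \<longleftrightarrow>
      (\<forall>i<k. x i = xs ! i)" for x
    by (auto simp: prod_emb_iff PiE_iff)
  then show ?thesis
    using assms by (simp add: set_eq_iff list_eq_iff_nth_eq)
qed

lemma sets_seed_law_cylinder:
  assumes "length xs = k"
  shows "{x. map x [0..<k] = xs} \<in> sets (seed_law r)"
  unfolding seed_law_def cylinder_eq_prod_emb[OF assms, of r]
  by (intro sets_PiM_I) auto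

text \<open>The dependence on \<open>r\<close> is isolated in a factor fixed by \<open>k\<close> and
  \<open>sum_list xs\<close>; thus cylinders with equal entry sum contribute to the same power of
  \<open>r\<close>.\<close>

lemma measure_seed_law_cylinder:
  assumes "length xs = k" "0 < r"
  shows "measure (seed_law r) {x. map x [0..<k] = xs} =
    exp (- real k * r) * r ^ sum_list xs * (\<Prod>i<k. 1 / fact (xs ! i))"
proof -
  interpret product_prob_space "\<lambda>i::nat. measure_pmf (poisson_pmf r)" UNIV ..
  have "measure (seed_law r) {x. map x [0..<k] = xs} = (\<Prod>i<k. pmf (poisson_pmf r) (xs ! i))"
    unfolding seed_law_def cylinder_eq_prod_emb[OF assms(1), of r]
    by (subst measure_PiM_emb) (auto simp: measure_pmf_single)
  also have "\<dots> = (\<Prod>i<k. exp (- r)) * (\<Prod>i<k. r ^ (xs ! i)) * (\<Prod>i<k. 1 / fact (xs ! i))"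
    using assms(2) by (simp add: prod.distrib[symmetric] mult_ac del: prod_constant)
  also have "(\<Prod>i<k. r ^ (xs ! i)) = r ^ sum_list xs"
    using assms(1) by (simp add: sum_list_sum_nth power_sum atLeast0LessThan)
  also have "(\<Prod>i<k. exp (- r)) = exp (- real k * r)"
    by (simp add: exp_of_nat_mult[symmetric])
  finally show ?thesis .
qed

section \<open>Power series and entire extensions for determined events\<close>

lemma tautologically_determined_power_series:
  assumes "tautologically_determined k E"
  obtains c :: "nat \<Rightarrow> real"
  where "E \<in> sets seed_algebra" "\<And>n. 0 \<le> c n"
    "\<And>r. 0 < r \<Longrightarrow> (\<lambda>n. c n * r ^ n) sums (exp (real k * r) * event_prob E r)"
proof -
  obtain B where B: "B \<subseteq> {xs. length xs = k}" and E: "E = {x. map x [0..<k] \<in> B}"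
    using assms by (auto simp: tautologically_determined_def)
  \<comment> \<open>\<open>natpermute n k\<close> consists of the lists of length \<open>k\<close>
    with sum \<open>n\<close>. It is finite, so \<open>E\<close> splits into countably many finite
    unions \<open>D n\<close> of cylinders, one for each power of \<open>r\<close>, and the
    coefficients \<open>c n\<close> do not depend on \<open>r\<close>.\<close>
  define c :: "nat \<Rightarrow> real" where "c = (\<lambda>n. \<Sum>xs\<in>B \<inter> natpermute n k. \<Prod>i<k. 1 / fact (xs ! i))"
  define D where "D = (\<lambda>n. \<Union>xs\<in>B \<inter> natpermute n k. {x. map x [0..<k] = xs})"
  have fin: "finite (B \<inter> natpermute n k)" for n
    by (simp add: natpermute_finite)
  have D_sets: "D n \<in> sets (seed_law r)" for n r
    unfolding D_def using B fin by (intro sets.finite_UN) (auto intro!: sets_seed_law_cylinder)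
  have disj: "disjoint_family D"
    by (auto simp: disjoint_family_on_def D_def natpermute_def)
  have ED: "E = (\<Union>n. D n)"
    using B by (auto simp: E D_def natpermute_def)
  have D_measure: "measure (seed_law r) (D n) = exp (- real k * r) * (c n * r ^ n)" if r: "0 < r" for n r
  proof -
    interpret prob_space "seed_law r" by (rule prob_space_seed_law)
    have "measure (seed_law r) (D n) =
        (\<Sum>xs\<in>B \<inter> natpermute n k. measure (seed_law r) {x. map x [0..<k] = xs})"
      unfolding D_def using B fin
      by (intro finite_measure_finite_Union)
        (auto simp: disjoint_family_on_def intro!: sets_seed_law_cylinder)
    also have "\<dots> = (\<Sum>xs\<in>B \<inter> natpermute n k.
        exp (- real k * r) * r ^ n * (\<Prod>i<k. 1 / fact (xs ! i)))"
      by (intro sum.cong refl, subst measure_seed_law_cylinder) (use r in \<open>auto simp: natpermute_def\<close>)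
    finally show ?thesis
      by (simp add: c_def sum_distrib_left sum_distrib_right mult_ac)
  qed
  have "(\<lambda>n. c n * r ^ n) sums (exp (real k * r) * event_prob E r)" if r: "0 < r" for r
  proof -
    interpret prob_space "seed_law r" by (rule prob_space_seed_law)
    have "(\<lambda>n. measure (seed_law r) (D n)) sums measure (seed_law r) E"
      unfolding ED using D_sets disj by (intro finite_measure_UNION) auto
    then have "(\<lambda>n. exp (real k * r) * measure (seed_law r) (D n)) sums
        (exp (real k * r) * measure (seed_law r) E)"
      by (rule sums_mult)
    moreover have "exp (real k * r) * measure (seed_law r) (D n) = c n * r ^ n" for n
      using r by (simp add: D_measure exp_minus)
    ultimately show ?thesis
      by (simp add: event_prob_def)
  qed
  \<comment> \<open>All seed laws share one sigma-algebra, so the parameter 1 is an arbitrary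
    choice.\<close>
  moreover have "E \<in> sets seed_algebra"
    unfolding ED sets_seed_law[of 1, symmetric] using D_sets by auto
  moreover have "0 \<le> c n" for n
    unfolding c_def by (intro sum_nonneg prod_nonneg) auto
  ultimately show thesis
    using that by blast
qed

text \<open>Since \<open>s\<close> is the geometric mean of \<open>r\<close> and
  \<open>s\<^sup>2 / r\<close>, each term at \<open>s\<close> is the product of the square roots of
  the terms at these two points. Cauchy-Schwarz for the partial sums then passes to the
  limit.\<close>

lemma Cauchy_Schwarz_power_series:
  fixes c :: "nat \<Rightarrow> real"
  assumes c: "\<And>n. 0 \<le> c n" and "0 < r" "0 \<le> s"
    and r: "(\<lambda>n. c n * r ^ n) sums u" and s: "(\<lambda>n. c n * (s\<^sup>2 / r) ^ n) sums v"
    and t: "(\<lambda>n. c n * s ^ n) sums w"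
  shows "w \<le> sqrt u * sqrt v"
proof -
  have pos: "0 \<le> c n * r ^ n" "0 \<le> c n * (s\<^sup>2 / r) ^ n" for n
    using assms by auto
  have "(\<Sum>n<N. c n * s ^ n) \<le> sqrt u * sqrt v" for N
  proof -
    have eq: "sqrt (c n * r ^ n) * sqrt (c n * (s\<^sup>2 / r) ^ n) = c n * s ^ n" for n
    proof -
      have "r ^ n * (s\<^sup>2 / r) ^ n = (r * (s\<^sup>2 / r)) ^ n"
        by (simp only: power_mult_distrib)
      also have "\<dots> = (s ^ n)\<^sup>2"
        using \<open>0 < r\<close> power_even_eq[of s n] power_mult[of s 2 n] by simp
      finally have "c n * r ^ n * (c n * (s\<^sup>2 / r) ^ n) = (c n * s ^ n)\<^sup>2"
        by (simp only: power2_eq_square mult_ac)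
      then have "sqrt (c n * r ^ n) * sqrt (c n * (s\<^sup>2 / r) ^ n) = \<bar>c n * s ^ n\<bar>"
        by (simp only: real_sqrt_mult[symmetric] real_sqrt_abs)
      then show ?thesis
        using c[of n] \<open>0 \<le> s\<close> by simp
    qed
    have "(\<Sum>n<N. c n * s ^ n)\<^sup>2 \<le> (\<Sum>n<N. c n * r ^ n) * (\<Sum>n<N. c n * (s\<^sup>2 / r) ^ n)"
      using Cauchy_Schwarz_ineq_sum[of "\<lambda>n. sqrt (c n * r ^ n)" "\<lambda>n. sqrt (c n * (s\<^sup>2 / r) ^ n)" "{..<N}"]
      unfolding eq real_sqrt_pow2[OF pos(1)] real_sqrt_pow2[OF pos(2)] .
    also have "\<dots> \<le> u * v"
    proof (intro mult_mono)
      show "(\<Sum>n<N. c n * r ^ n) \<le> u"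
        using sum_le_suminf[OF sums_summable[OF r] finite_lessThan, of N] pos(1) sums_unique[OF r] by simp
      show "(\<Sum>n<N. c n * (s\<^sup>2 / r) ^ n) \<le> v"
        using sum_le_suminf[OF sums_summable[OF s] finite_lessThan, of N] pos(2) sums_unique[OF s] by simp
      show "0 \<le> u"
        using sums_le[OF pos(1) sums_zero r] .
      show "0 \<le> (\<Sum>n<N. c n * (s\<^sup>2 / r) ^ n)"
        using pos by (intro sum_nonneg)
    qed
    finally show ?thesis
      unfolding real_sqrt_mult[symmetric] by (rule real_le_rsqrt)
  qed
  then show ?thesis
    using t unfolding sums_def by (intro LIMSEQ_le_const2) auto
qed

text \<open>The factor \<open>exp (- of_nat k * z)\<close> undoes the normalisation of the power
  series. The bound excludes \<open>z = 0\<close> because its proof uses \<open>norm z\<close> and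
  \<open>(norm z)\<^sup>2 / r\<close> as Poisson parameters, which must be positive.\<close>

lemma event_prob_entire_extension:
  assumes "tautologically_determined k E"
  obtains G :: "complex \<Rightarrow> complex"
  where "G holomorphic_on UNIV"
    "\<And>r. 0 < r \<Longrightarrow> G (of_real r) = of_real (event_prob E r)"
    "\<And>r z. 0 < r \<Longrightarrow> z \<noteq> 0 \<Longrightarrow>
       norm (G z) \<le> sqrt (event_prob E r) * exp (real k * (norm (z - of_real r))\<^sup>2 / (2 * r))"
proof -
  obtain c where c: "\<And>n. 0 \<le> c n"
    and sums: "\<And>r. 0 < r \<Longrightarrow> (\<lambda>n. c n * r ^ n) sums (exp (real k * r) * event_prob E r)"
    using tautologically_determined_power_series[OF assms] by metis
  define H :: "complex \<Rightarrow> complex" where "H = (\<lambda>z. \<Sum>n. of_real (c n) * z ^ n)"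
  define G where "G = (\<lambda>z. exp (- of_nat k * z) * H z)"
  \<comment> \<open>As the coefficients are nonnegative, the absolute values of the terms at
    \<open>z\<close> form the real series at \<open>norm z\<close>. This gives convergence
    everywhere as well as the first bound on \<open>H\<close>.\<close>
  have norm_sums: "(\<lambda>n. norm (of_real (c n) * z ^ n)) sums
      (exp (real k * norm z) * event_prob E (norm z))" if "z \<noteq> 0" for z :: complex
    using sums[of "norm z"] that c by (simp add: norm_mult norm_power)
  have H_sums: "(\<lambda>n. of_real (c n) * z ^ n) sums H z" for z
  proof (cases "z = 0")
    case True
    then show ?thesis
      using powser_sums_zero[of "\<lambda>n. complex_of_real (c n)"] by (simp add: H_def powser_zero)
  next
    case False
    then show ?thesis
      using norm_sums summable_norm_cancel unfolding H_def by (metis summable_sums sums_summable)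
  qed
  have "H holomorphic_on ball 0 R" for R
    by (rule power_series_holomorphic[of _ _ "\<lambda>n. of_real (c n)"]) (simp add: H_sums)
  then have "H holomorphic_on (\<Union>R. ball 0 R)"
    by (intro holomorphic_on_UN_open) auto
  moreover have "(\<Union>R. ball (0::complex) R) = UNIV"
    by (auto intro: gt_ex)
  ultimately have "H holomorphic_on UNIV"
    by simp
  then have hol: "G holomorphic_on UNIV"
    unfolding G_def by (intro holomorphic_intros)
  have real: "G (of_real r) = of_real (event_prob E r)" if r: "0 < r" for r
  proof -
    have "H (of_real r) = of_real (exp (real k * r) * event_prob E r)"
      using H_sums[of "of_real r"] sums_of_real[OF sums[OF r], where 'a = complex]
      by (auto intro: sums_unique2)
    then have "G (of_real r) = of_real (exp (- real k * r) * (exp (real k * r) * event_prob E r))"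
      by (simp add: G_def exp_of_real[symmetric])
    then show ?thesis
      by (simp add: exp_minus)
  qed
  have bound: "norm (G z) \<le> sqrt (event_prob E r) * exp (real k * (norm (z - of_real r))\<^sup>2 / (2 * r))"
    if r: "0 < r" and z: "z \<noteq> 0" for r z
  proof -
    define s where "s = norm z"
    have s: "0 < s" "0 < s\<^sup>2 / r"
      using z r by (auto simp: s_def)
    interpret S: prob_space "seed_law (s\<^sup>2 / r)" by (rule prob_space_seed_law)
    have "norm (H z) \<le> exp (real k * s) * event_prob E s"
      using norm_sums[OF z] H_sums[of z] summable_norm unfolding s_def
      by (metis sums_iff)
    also have "\<dots> \<le> sqrt (exp (real k * r) * event_prob E r) *
        sqrt (exp (real k * (s\<^sup>2 / r)) * event_prob E (s\<^sup>2 / r))"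
      using c r s by (intro Cauchy_Schwarz_power_series[of c r s] sums) auto
    also have "\<dots> \<le> sqrt (exp (real k * r) * event_prob E r) *
        sqrt (exp (real k * (s\<^sup>2 / r)) * 1)"
      by (intro mult_left_mono real_sqrt_le_mono)
        (auto simp: event_prob_def)
    also have "\<dots> = sqrt (event_prob E r) * (exp (real k * r / 2) * exp (real k * (s\<^sup>2 / r) / 2))"
      by (simp add: real_sqrt_mult sqrt_exp)
    finally have "norm (G z) \<le> exp (- real k * Re z) *
        (sqrt (event_prob E r) * (exp (real k * r / 2) * exp (real k * (s\<^sup>2 / r) / 2)))"
      by (simp add: G_def norm_mult)
    also have "\<dots> = sqrt (event_prob E r) *
        exp (- real k * Re z + real k * r / 2 + real k * (s\<^sup>2 / r) / 2)"
      by (simp only: exp_add mult_ac)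
    \<comment> \<open>The three exponents complete a square, so the growth is quadratic in the
      distance to \<open>r\<close> and vanishes at \<open>z = r\<close>.\<close>
    also have "- real k * Re z + real k * r / 2 + real k * (s\<^sup>2 / r) / 2 =
        real k * (norm (z - of_real r))\<^sup>2 / (2 * r)"
    proof -
      have eq: "(norm (z - of_real r))\<^sup>2 = s\<^sup>2 - 2 * r * Re z + r\<^sup>2"
        unfolding s_def cmod_power2 by (simp add: power2_eq_square algebra_simps)
      show ?thesis
        unfolding eq using r by (simp add: field_simps power2_eq_square)
    qed
    finally show ?thesis .
  qed
  show thesis
    using that hol real bound by blast
qed

section \<open>Comparing determined events\<close>

text \<open>Dropping the last entry with \<open>butlast\<close> recovers the shorter prefix. This
  puts consecutive approximations on a common level.\<close>

lemma tautologically_determined_Suc: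
  assumes "tautologically_determined k E"
  shows "tautologically_determined (Suc k) E"
proof -
  obtain B where B: "B \<subseteq> {xs. length xs = k}" "E = {x. map x [0..<k] \<in> B}"
    using assms by (auto simp: tautologically_determined_def)
  show ?thesis
    unfolding tautologically_determined_def
    by (rule exI[of _ "{xs. length xs = Suc k \<and> butlast xs \<in> B}"]) (auto simp: B(2))
qed

lemma tautologically_determined_Diff:
  assumes "tautologically_determined k E" "tautologically_determined k F"
  shows "tautologically_determined k (E - F)"
proof -
  obtain B where B: "B \<subseteq> {xs. length xs = k}" "E = {x. map x [0..<k] \<in> B}"
    using assms(1) by (auto simp: tautologically_determined_def)
  obtain B' where B': "F = {x. map x [0..<k] \<in> B'}"
    using assms(2) by (auto simp: tautologically_determined_def)
  show ?thesis
    unfolding tautologically_determined_def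
    by (rule exI[of _ "B - B'"]) (use B B' in auto)
qed

lemma tautologically_determined_sets:
  "tautologically_determined k E \<Longrightarrow> E \<in> sets seed_algebra"
  by (rule tautologically_determined_power_series)

lemma event_prob_diff:
  assumes "E \<in> sets seed_algebra" "F \<in> sets seed_algebra"
  shows "event_prob E r - event_prob F r = event_prob (E - F) r - event_prob (F - E) r"
proof -
  interpret prob_space "seed_law r" by (rule prob_space_seed_law)
  show ?thesis
    using assms finite_measure_Diff'[of E F] finite_measure_Diff'[of F E]
    by (simp add: event_prob_def sets_seed_law Int_commute)
qed

lemma event_prob_mono:
  assumes "E \<subseteq> F" "F \<in> sets seed_algebra"
  shows "event_prob E r \<le> event_prob F r"
proof -
  interpret prob_space "seed_law r" by (rule prob_space_seed_law)
  show ?thesis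
    using assms finite_measure_mono[of E F] by (simp add: event_prob_def sets_seed_law)
qed

lemma event_prob_Un_le:
  assumes "E \<in> sets seed_algebra" "F \<in> sets seed_algebra"
  shows "event_prob (E \<union> F) r \<le> event_prob E r + event_prob F r"
proof -
  interpret prob_space "seed_law r" by (rule prob_space_seed_law)
  show ?thesis
    using assms measure_Un_le[of E "seed_law r" F] by (simp add: event_prob_def sets_seed_law)
qed

lemma abs_event_prob_diff_le:
  assumes "E \<in> sets seed_algebra" "F \<in> sets seed_algebra"
  shows "\<bar>event_prob E r - event_prob F r\<bar> \<le> event_prob (sym_diff E F) r"
proof -
  have "event_prob (E - F) r \<le> event_prob (sym_diff E F) r"
    "event_prob (F - E) r \<le> event_prob (sym_diff E F) r"
    using assms by (auto intro!: event_prob_mono)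
  moreover have "0 \<le> event_prob (E - F) r" "0 \<le> event_prob (F - E) r"
    by (simp_all add: event_prob_def)
  ultimately show ?thesis
    using event_prob_diff[OF assms, of r] by linarith
qed

text \<open>The series of a difference may have coefficients of both signs, so the bound is applied
  separately to \<open>E - F\<close> and \<open>F - E\<close>. Both lie in the symmetric difference,
  whence the factor 2.\<close>

lemma event_prob_diff_entire_extension:
  assumes "tautologically_determined k E" "tautologically_determined k F"
  obtains G :: "complex \<Rightarrow> complex"
  where "G holomorphic_on UNIV"
    "\<And>r. 0 < r \<Longrightarrow> G (of_real r) = of_real (event_prob E r - event_prob F r)"
    "\<And>r z. 0 < r \<Longrightarrow> z \<noteq> 0 \<Longrightarrow> norm (G z) \<le>
       2 * sqrt (event_prob (sym_diff E F) r) * exp (real k * (norm (z - of_real r))\<^sup>2 / (2 * r))"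
proof -
  note [intro] = tautologically_determined_sets[OF assms(1)] tautologically_determined_sets[OF assms(2)]
  obtain G1 where G1: "G1 holomorphic_on UNIV"
    "\<And>r. 0 < r \<Longrightarrow> G1 (of_real r) = of_real (event_prob (E - F) r)"
    "\<And>r z. 0 < r \<Longrightarrow> z \<noteq> 0 \<Longrightarrow> norm (G1 z) \<le>
       sqrt (event_prob (E - F) r) * exp (real k * (norm (z - of_real r))\<^sup>2 / (2 * r))"
    using event_prob_entire_extension[OF tautologically_determined_Diff[OF assms]] by metis
  obtain G2 where G2: "G2 holomorphic_on UNIV"
    "\<And>r. 0 < r \<Longrightarrow> G2 (of_real r) = of_real (event_prob (F - E) r)"
    "\<And>r z. 0 < r \<Longrightarrow> z \<noteq> 0 \<Longrightarrow> norm (G2 z) \<le>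
       sqrt (event_prob (F - E) r) * exp (real k * (norm (z - of_real r))\<^sup>2 / (2 * r))"
    using event_prob_entire_extension[OF tautologically_determined_Diff[OF assms(2,1)]] by metis
  show thesis
  proof (rule that)
    show "(\<lambda>z. G1 z - G2 z) holomorphic_on UNIV"
      using G1(1) G2(1) by (intro holomorphic_intros)
    show "G1 (of_real r) - G2 (of_real r) = of_real (event_prob E r - event_prob F r)" if "0 < r" for r
      using that by (subst event_prob_diff) (auto simp: G1(2) G2(2))
    fix r :: real and z :: complex
    assume rz: "0 < r" "z \<noteq> 0"
    let ?e = "exp (real k * (norm (z - of_real r))\<^sup>2 / (2 * r))"
    have "sqrt (event_prob (E - F) r) * ?e \<le> sqrt (event_prob (sym_diff E F) r) * ?e"
      "sqrt (event_prob (F - E) r) * ?e \<le> sqrt (event_prob (sym_diff E F) r) * ?e"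
      by (auto intro!: event_prob_mono)
    then show "norm (G1 z - G2 z) \<le> 2 * sqrt (event_prob (sym_diff E F) r) * ?e"
      using G1(3)[OF rz] G2(3)[OF rz] norm_triangle_ineq4[of "G1 z" "G2 z"] by linarith
  qed
qed

section \<open>Summing the increments to an extension of the limit\<close>

lemma holomorphic_on_suminf:
  fixes h :: "nat \<Rightarrow> complex \<Rightarrow> complex"
  assumes "open S" and hol: "\<And>n. h n holomorphic_on S"
    and bound: "\<And>n z. z \<in> S \<Longrightarrow> norm (h n z) \<le> M n" and "summable M"
  shows "(\<lambda>z. \<Sum>n. h n z) holomorphic_on S"
proof (rule holomorphic_uniform_sequence[OF \<open>open S\<close>])
  show "(\<lambda>z. \<Sum>n<N. h n z) holomorphic_on S" for N
    using hol by (intro holomorphic_intros)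
  fix z assume "z \<in> S"
  then obtain d where d: "0 < d" "cball z d \<subseteq> S"
    using \<open>open S\<close> by (auto simp: open_contains_cball)
  have "uniform_limit (cball z d) (\<lambda>N z. \<Sum>n<N. h n z) (\<lambda>z. \<Sum>n. h n z) sequentially"
    using bound d(2) by (intro Weierstrass_m_test[where M = M] \<open>summable M\<close>) auto
  with d show "\<exists>d>0. cball z d \<subseteq> S \<and>
      uniform_limit (cball z d) (\<lambda>N z. \<Sum>n<N. h n z) (\<lambda>z. \<Sum>n. h n z) sequentially"
    by blast
qed

theorem theorem1p5:
  fixes l0 l1 :: ereal and P :: "otree \<Rightarrow> bool"
  assumes "0 \<le> l0" and "l0 < l1" and "l1 \<le> \<infinity>"
    and "tree_event P \<in> sets seed_algebra"
    and "rapidly_determined (tree_event P) (einterval l0 l1)"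
  shows "real_analytic_on (event_prob (tree_event P)) (einterval l0 l1)"
proof -
  define A where "A = tree_event P"
  define I where "I = einterval l0 l1"
  have A_sets: "A \<in> sets seed_algebra"
    using assms(4) by (simp add: A_def)
  have I_pos: "0 < x" if "x \<in> I" for x
    using that assms(1) by (auto simp: I_def einterval_def dest: le_less_trans)
  obtain Ak where Ak: "\<And>k. 1 \<le> k \<Longrightarrow> tautologically_determined k (Ak k)"
    and rapid: "\<And>r. r \<in> I \<Longrightarrow> \<exists>c>0. \<exists>C>0. \<exists>k0::nat. \<forall>k\<ge>1. k \<ge> k0 \<longrightarrow>
      event_prob (sym_diff A (Ak k)) r \<le> C * exp (- c * real k)"
    using assms(5) unfolding rapidly_determined_def A_def I_def event_prob_def by blast
  have Ak_sets: "Ak k \<in> sets seed_algebra" if "1 \<le> k" for k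
    using tautologically_determined_sets[OF Ak[OF that]] .
  \<comment> \<open>The constants may vary with \<open>x\<close>, since only pointwise convergence
    is extracted here. The uniform estimate on a disc will come from the decay at its centre
    alone.\<close>
  have lim: "(\<lambda>k. event_prob (Ak k) x) \<longlonglongrightarrow> event_prob A x" if x: "x \<in> I" for x
  proof -
    obtain c C k0 where c: "0 < c" and k0: "\<And>k. 1 \<le> k \<Longrightarrow> k0 \<le> k \<Longrightarrow>
        event_prob (sym_diff A (Ak k)) x \<le> C * exp (- c * real k)"
      using rapid[OF x] by blast
    have "\<forall>\<^sub>F k in sequentially.
        norm (event_prob (Ak k) x - event_prob A x) \<le> C * exp (- c * real k)"
      using eventually_ge_at_top[of "max 1 k0"]
    proof eventually_elim
      case (elim k)
      then show ?case
        using k0[of k] abs_event_prob_diff_le[OF A_sets Ak_sets, of k x] by auto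
    qed
    moreover have "(\<lambda>k. C * exp (- c * real k)) \<longlonglongrightarrow> 0"
      using c by real_asymp
    ultimately have "(\<lambda>k. event_prob (Ak k) x - event_prob A x) \<longlonglongrightarrow> 0"
      by (rule Lim_null_comparison)
    then show ?thesis
      by (simp add: LIM_zero_iff)
  qed
  have "\<exists>\<delta>>0. \<exists>g :: complex \<Rightarrow> complex. g analytic_on cball (of_real r) \<delta> \<and>
      (\<forall>x\<in>I. of_real x \<in> cball (of_real r :: complex) \<delta> \<longrightarrow> g (of_real x) = of_real (event_prob A x))"
    if r: "r \<in> I" for r
  proof -
    have r0: "0 < r"
      using I_pos[OF r] .
    obtain c C k0 where c: "0 < c" and C: "0 < C" and k0: "\<And>k. 1 \<le> k \<Longrightarrow> k0 \<le> k \<Longrightarrow>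
        event_prob (sym_diff A (Ak k)) r \<le> C * exp (- c * real k)"
      using rapid[OF r] by blast
    \<comment> \<open>From this index on, \<open>Ak\<close> is determined and the decay estimate
      holds.\<close>
    define K where "K = max 1 k0"
    have K: "1 \<le> K + n" "k0 \<le> K + n" for n
      by (auto simp: K_def)
    \<comment> \<open>Two consecutive approximations can differ only where one of them differs from
      \<open>A\<close>; the later of the two error bounds is the smaller one.\<close>
    have D_le: "event_prob (sym_diff (Ak (Suc (K + n))) (Ak (K + n))) r \<le> 2 * C * exp (- c * real (K + n))"
      for n
    proof -
      have sets: "A \<in> sets seed_algebra" "Ak (K + n) \<in> sets seed_algebra" "Ak (Suc (K + n)) \<in> sets seed_algebra"
        using A_sets Ak_sets K[of n] by auto
      have "event_prob (sym_diff (Ak (Suc (K + n))) (Ak (K + n))) r \<le>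
          event_prob (sym_diff A (Ak (K + n)) \<union> sym_diff A (Ak (Suc (K + n)))) r"
        using sets by (intro event_prob_mono) auto
      also have "\<dots> \<le> event_prob (sym_diff A (Ak (K + n))) r + event_prob (sym_diff A (Ak (Suc (K + n)))) r"
        using sets by (intro event_prob_Un_le) auto
      also have "\<dots> \<le> C * exp (- c * real (K + n)) + C * exp (- c * real (Suc (K + n)))"
        using k0[of "K + n"] k0[of "Suc (K + n)"] K[of n] by auto
      also have "\<dots> \<le> C * exp (- c * real (K + n)) + C * exp (- c * real (K + n))"
        using c C by (intro add_left_mono mult_left_mono) (auto simp: algebra_simps)
      finally show ?thesis by simp
    qed
    have "\<exists>G. G holomorphic_on UNIV \<and>
       (\<forall>x>0. G (of_real x) = of_real (event_prob (Ak (Suc (K + n))) x - event_prob (Ak (K + n)) x)) \<and>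
       (\<forall>x>0. \<forall>z. z \<noteq> 0 \<longrightarrow> norm (G z) \<le>
         2 * sqrt (event_prob (sym_diff (Ak (Suc (K + n))) (Ak (K + n))) x) *
         exp (real (Suc (K + n)) * (norm (z - of_real x))\<^sup>2 / (2 * x)))" for n
      using event_prob_diff_entire_extension[OF Ak[of "Suc (K + n)"]
          tautologically_determined_Suc[OF Ak[OF K(1)[of n]]]] by (metis le_SucI K(1))
    then obtain h :: "nat \<Rightarrow> complex \<Rightarrow> complex" where h: "\<And>n. h n holomorphic_on UNIV"
      "\<And>n x. 0 < x \<Longrightarrow> h n (of_real x) =
         of_real (event_prob (Ak (Suc (K + n))) x - event_prob (Ak (K + n)) x)"
      "\<And>n x z. 0 < x \<Longrightarrow> z \<noteq> 0 \<Longrightarrow> norm (h n z) \<le>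
         2 * sqrt (event_prob (sym_diff (Ak (Suc (K + n))) (Ak (K + n))) x) *
         exp (real (Suc (K + n)) * (norm (z - of_real x))\<^sup>2 / (2 * x))"
      by metis
    obtain G where G: "G holomorphic_on UNIV" "\<And>x. 0 < x \<Longrightarrow> G (of_real x) = of_real (event_prob (Ak K) x)"
      using event_prob_entire_extension[OF Ak[of K]] K(1)[of 0] by (metis add_0_right)
    \<comment> \<open>On the disc of radius \<open>d\<close> the factor \<open>exp ((k + 1) d\<^sup>2 / (2 r))\<close> costs at most half of the
      decay \<open>exp (- c k / 2)\<close> coming from the square root.\<close>
    define d where "d = min r (sqrt (r * c / 2))"
    have d: "0 < d" "d \<le> r" "d\<^sup>2 \<le> r * c / 2"
    proof -
      show "0 < d" "d \<le> r"
        using r0 c by (auto simp: d_def)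
      then have "d\<^sup>2 \<le> (sqrt (r * c / 2))\<^sup>2"
        by (intro power_mono) (auto simp: d_def)
      then show "d\<^sup>2 \<le> r * c / 2"
        using r0 c by simp
    qed
    \<comment> \<open>With \<open>k = K + n\<close>, the square root of \<open>D_le\<close> decays
      like \<open>exp (- c * k / 2)\<close> and the quadratic factor grows at most like
      \<open>exp (c * (k + 1) / 4)\<close>. Their product is
      \<open>exp (c / 4) * exp (- c * k / 4)\<close>, and the factor
      \<open>exp (- c * K / 4)\<close>, at most 1, is dropped.\<close>
    define M where "M = (\<lambda>n. 2 * sqrt (2 * C) * exp (c / 4) * exp (- c / 4) ^ n)"
    have summable_M: "summable M"
      unfolding M_def using c by (intro summable_mult summable_geometric) auto
    have h_le: "norm (h n z) \<le> M n" if z: "z \<in> ball (of_real r) d" for n z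
    proof -
      have zd: "norm (z - of_real r) \<le> d"
        using z by (simp add: dist_norm norm_minus_commute)
      \<comment> \<open>The choice \<open>d \<le> r\<close> keeps the origin out of the open
        disc.\<close>
      have z0: "z \<noteq> 0"
        using z d(2) r0 by (auto simp: dist_norm)
      have "norm (z - of_real r) ^ 2 / (2 * r) \<le> c / 4"
      proof -
        have "norm (z - of_real r) ^ 2 \<le> r * c / 2"
          using power_mono[OF zd norm_ge_zero, of 2] d(3) by simp
        then show ?thesis
          using r0 by (simp add: field_simps)
      qed
      then have e: "real (Suc (K + n)) * ((norm (z - of_real r))\<^sup>2 / (2 * r)) \<le> real (Suc (K + n)) * (c / 4)"
        by (intro mult_left_mono) auto
      have "norm (h n z) \<le> 2 * sqrt (event_prob (sym_diff (Ak (Suc (K + n))) (Ak (K + n))) r) *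
         exp (real (Suc (K + n)) * (norm (z - of_real r))\<^sup>2 / (2 * r))"
        by (rule h(3)[OF r0 z0])
      also have "\<dots> \<le> 2 * sqrt (2 * C * exp (- c * real (K + n))) * exp (real (Suc (K + n)) * (c / 4))"
        using D_le[of n] e C by (intro mult_mono mult_left_mono real_sqrt_le_mono) auto
      also have "\<dots> = 2 * sqrt (2 * C) * (exp (- c * real (K + n) / 2) * exp (real (Suc (K + n)) * (c / 4)))"
        by (simp add: real_sqrt_mult sqrt_exp)
      also have "exp (- c * real (K + n) / 2) * exp (real (Suc (K + n)) * (c / 4)) =
          exp (c / 4) * exp (- (c / 4) * real (K + n))"
        by (simp add: exp_add[symmetric] field_simps)
      also have "exp (- (c / 4) * real (K + n)) \<le> exp (- c / 4) ^ n"
        using c by (simp add: exp_of_nat_mult[symmetric] algebra_simps)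
      finally show ?thesis
        using C by (simp add: M_def mult_ac)
    qed
    \<comment> \<open>\<open>G\<close> extends the probability of \<open>Ak K\<close>, and the
      \<open>h n\<close> extend the successive increments.\<close>
    define g where "g = (\<lambda>z. G z + (\<Sum>n. h n z))"
    have "(\<lambda>z. \<Sum>n. h n z) holomorphic_on ball (of_real r) d"
      using h(1) by (intro holomorphic_on_suminf[OF _ _ h_le summable_M])
        (auto intro: holomorphic_on_subset)
    then have "g holomorphic_on ball (of_real r) d"
      unfolding g_def using G(1) by (intro holomorphic_intros) (auto intro: holomorphic_on_subset)
    then have "g analytic_on ball (of_real r) d"
      by (simp add: analytic_on_open)
    \<comment> \<open>Halving the radius places the closed disc inside the open one.\<close>
    then have "g analytic_on cball (of_real r) (d / 2)"
      by (rule analytic_on_subset) (use d in auto)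
    \<comment> \<open>This holds on all of \<open>I\<close>, even outside the disc: on the real
      points the series converges by telescoping and \<open>lim\<close>, without the majorant
      \<open>M\<close>.\<close>
    moreover have "g (of_real x) = of_real (event_prob A x)" if x: "x \<in> I" for x
    proof -
      have "(\<lambda>n. event_prob (Ak (K + n)) x) \<longlonglongrightarrow> event_prob A x"
        using LIMSEQ_ignore_initial_segment[OF lim[OF x], of K] by (simp add: add.commute)
      then have "(\<lambda>n. event_prob (Ak (K + Suc n)) x - event_prob (Ak (K + n)) x) sums
          (event_prob A x - event_prob (Ak (K + 0)) x)"
        by (rule telescope_sums)
      then have "(\<lambda>n. h n (of_real x)) sums of_real (event_prob A x - event_prob (Ak K) x)"
        using sums_of_real[where 'a = complex] by (simp add: h(2)[OF I_pos[OF x]] flip: of_real_diff)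
      then show ?thesis
        using G(2)[OF I_pos[OF x]] by (simp add: g_def sums_iff)
    qed
    ultimately show ?thesis
      using d(1) by (intro exI[of _ "d / 2"]) auto
  qed
  then show ?thesis
    unfolding real_analytic_on_def A_def I_def by blast
qed

end
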